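(* Let $n\ge 1$ and $k\ge 2$ be integers, and let $M_{k-1}$ denote the sum of the $k-1$ largest binomial coefficients $\binom{n}{i}$, $0\le i\le n$ (i.e. $M_{k-1}=\sum_{i=\lceil (n-k+2)/2\rceil}^{\lceil (n+k-2)/2\rceil}\binom{n}{i}$). If $\mathcal{F}$ is a family of subsets of $[n]$ of size $M_{k-1}+t$, then $\mathcal{F}$ contains at least $t\binom{\lfloor (n+k)/2\rfloor}{k-1}(k-1)!$ $k$-chains.
   Context: A $k$-chain in $\mathcal{F}$ is a collection of $k$ sets $F_1,\dots,F_k\in\mathcal{F}$ with $F_1\subsetneq F_2\subsetneq\cdots\subsetneq F_k$; the number of $k$-chains is the number of such $k$-element subfamilies of $\mathcal{F}$ that are totally ordered by inclusion. *)

theory Defs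
  imports Complex_Main "HOL-Library.Multiset"
begin

(* Largest with multiplicity: equal coefficients count separately.
   If m > n + 1 this is the sum of all n + 1 coefficients. *)
definition largest_binomials_sum :: "nat \<Rightarrow> nat \<Rightarrow> nat" where
  "largest_binomials_sum n m =
     sum_list (take m (rev (sort (map (\<lambda>i. n choose i) [0..<Suc n]))))"

definition k_chains :: "nat \<Rightarrow> 'a set set \<Rightarrow> 'a set set set" where
  "k_chains k F = {C \<in> chains F. card C = k}"

lemma sum_list_take_largest:
  fixes f :: "'a \<Rightarrow> nat"
  assumes A: "finite A" and S: "S \<subseteq> A"
    and xs: "distinct xs" "set xs = A"
    and ge: "\<And>i j. i \<in> S \<Longrightarrow> j \<in> A - S \<Longrightarrow> f j \<le> f i"
  shows "sum_list (take (card S) (rev (sort (map f xs)))) = sum f S"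
proof -
  define ys where "ys = filter (\<lambda>x. x \<in> S) xs"
  define zs where "zs = filter (\<lambda>x. x \<notin> S) xs"
  have ys: "distinct ys" "set ys = S" and zs: "set zs = A - S"
    using xs S by (auto simp: ys_def zs_def)
  have "sorted (sort (map f zs) @ sort (map f ys))"
    using ge ys zs by (auto simp: sorted_append)
  moreover have "mset (sort (map f zs) @ sort (map f ys)) = mset (map f xs)"
    using multiset_partition[of "mset xs" "\<lambda>x. x \<in> S"]
    by (simp add: ys_def zs_def add.commute flip: image_mset_union)
  ultimately have "sort (map f xs) = sort (map f zs) @ sort (map f ys)"
    by (metis properties_for_sort)
  moreover have "length ys = card S"
    using ys distinct_card by metis
  ultimately have "sum_list (take (card S) (rev (sort (map f xs)))) = sum_list (sort (map f ys))"
    by (simp add: sum_list_rev)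
  also have "\<dots> = sum_list (map f ys)"
    by (metis mset_sort sum_mset_sum_list)
  also have "\<dots> = sum f S"
    using ys by (simp add: sum_list_distinct_conv_sum_set)
  finally show ?thesis .
qed

lemma binomial_le_central:
  assumes "\<bar>int n - 2 * int i\<bar> \<le> \<bar>int n - 2 * int j\<bar>" "i \<le> n" "j \<le> n"
  shows "n choose j \<le> n choose i"
proof -
  define r where "r = (\<lambda>i. min i (n - i))"
  have r: "n choose r l = n choose l" if "l \<le> n" for l
    using that binomial_symmetric[of l n] by (auto simp: r_def min_def)
  have "r j \<le> r i" "2 * r i \<le> n"
    using assms by (auto simp: r_def min_def)
  hence "n choose r j \<le> n choose r i" by (intro binomial_mono)
  with r assms show ?thesis by simp
qed

lemma largest_binomials_sum_eq:
  assumes k: "k \<ge> 2"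
  shows "largest_binomials_sum n (k - 1) =
    (\<Sum>i | i \<le> n \<and> \<lceil>(real n - real k + 2) / 2\<rceil> \<le> int i \<and> int i \<le> \<lceil>(real n + real k - 2) / 2\<rceil>. n choose i)"
proof -
  define S where "S = {i. i \<le> n \<and> n + 2 \<le> 2 * i + k \<and> 2 * i < n + k}"
  have "{i. i \<le> n \<and> \<lceil>(real n - real k + 2) / 2\<rceil> \<le> int i \<and> int i \<le> \<lceil>(real n + real k - 2) / 2\<rceil>} = S"
    unfolding S_def by (auto simp: ceiling_le_iff le_ceiling_iff)
  moreover have "largest_binomials_sum n (k - 1) = (\<Sum>i\<in>S. n choose i)"
  proof -
    have S: "S \<subseteq> {..n}" by (auto simp: S_def)
    have *: "sum_list (take (card S) (rev (sort (map (\<lambda>i. n choose i) [0..<Suc n])))) = (\<Sum>i\<in>S. n choose i)"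
    proof (rule sum_list_take_largest[of "{..n}"])
      fix i j assume "i \<in> S" "j \<in> {..n} - S"
      thus "n choose j \<le> n choose i"
        by (intro binomial_le_central) (auto simp: S_def)
    qed (use S in auto)
    show ?thesis
    proof (cases "k \<le> n + 2")
      case True
      have "S = {(n + 3 - k) div 2 .. (n + k - 1) div 2}"
        using True k by (auto simp: S_def)
      hence "card S = k - 1" using True k by simp
      with * show ?thesis by (simp add: largest_binomials_sum_def)
    next
      case False
      hence "S = {..n}" by (auto simp: S_def)
      with False * show ?thesis by (simp add: largest_binomials_sum_def)
    qed
  qed
  ultimately show ?thesis by simp
qed

end

theory Submission
  imports Defs "HOL-Combinatorics.Multiset_Permutations"
begin

text \<open>
  A uniformly random maximal chain of the cube (a permutation \<open>xs\<close> with its prefix sets) meets \<open>F\<close> in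
  the levels of a random set \<open>X\<close>. Weighting level \<open>i\<close> by \<open>n choose i\<close> and a set \<open>T\<close> of \<open>k\<close> levels by
  the number of chains with these sizes, the expected weights are \<open>|F|\<close> and the number of \<open>k\<close>-chains
  of \<open>F\<close>. So it suffices to prove the inequality for every fixed \<open>X\<close>, that is, for unions of full levels.
  There one removes a level \<open>a\<close> farthest from \<open>n/2\<close>: the remaining levels chosen for a chain through
  it lie on the same side of \<open>a\<close>, within a cube of dimension at least \<open>(n + k) div 2\<close>, and if
  they avoid the levels \<open>0\<close> and \<open>n\<close>, every set on level \<open>a\<close> lies on enough chains.
  Avoiding \<open>0\<close> and \<open>n\<close> is impossible only if \<open>X\<close> consists of \<open>0\<close>, \<open>n\<close> and \<open>k - 2\<close> further levels.
\<close>

subsection \<open>Products of factorials of gaps\<close>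

text \<open>The list is meant to be decreasing and the first argument is the current upper end, so
  the empty list contributes the lowest gap, the one down to 0.\<close>

fun gap_fact_list :: "nat \<Rightarrow> nat list \<Rightarrow> nat" where
  "gap_fact_list n [] = fact n"
| "gap_fact_list n (b # bs) = fact (n - b) * gap_fact_list b bs"

text \<open>
  For \<open>T = {a\<^sub>1 < \<dots> < a\<^sub>k}\<close> this is \<open>a\<^sub>1! (a\<^sub>2 - a\<^sub>1)! \<dots> (n - a\<^sub>k)!\<close>, the number of permutations of an
  \<open>n\<close>-element set that pass through a fixed chain of sets of sizes \<open>a\<^sub>1, \<dots>, a\<^sub>k\<close>.
\<close>
definition gap_fact :: "nat \<Rightarrow> nat set \<Rightarrow> nat" where
  "gap_fact n T = gap_fact_list n (rev (sorted_list_of_set T))"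

lemma gap_fact_empty [simp]: "gap_fact n {} = fact n"
  by (simp add: gap_fact_def)

lemma gap_fact_insert_Max:
  assumes "finite A" "\<And>x. x \<in> A \<Longrightarrow> x < b"
  shows "gap_fact n (insert b A) = fact (n - b) * gap_fact b A"
proof -
  have "b \<notin> A" using assms(2) by blast
  have "sorted_list_of_set (insert b A) = sorted_list_of_set A @ [b]"
  proof -
    have "sorted (sorted_list_of_set A @ [b])" "distinct (sorted_list_of_set A @ [b])"
      using assms \<open>b \<notin> A\<close> by (auto simp: sorted_append intro: less_imp_le)
    hence "sorted_list_of_set (set (sorted_list_of_set A @ [b])) = sorted_list_of_set A @ [b]"
      by (rule sorted_list_of_set.idem_if_sorted_distinct)
    thus ?thesis using assms by simp
  qed
  thus ?thesis by (simp add: gap_fact_def)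
qed

lemma gap_fact_pos: "finite A \<Longrightarrow> gap_fact n A > 0"
  by (induction A arbitrary: n rule: finite_linorder_max_induct)
     (auto simp: gap_fact_insert_Max)

text \<open>Gaps above a depend only on differences, so levels above a become levels of a cube of
  dimension n - a.\<close>

lemma gap_fact_insert_Min:
  assumes "finite B" "B \<subseteq> {a<..n}" "a \<le> n"
  shows "gap_fact n (insert a B) = gap_fact (n - a) ((\<lambda>x. x - a) ` B) * fact a"
  using assms
proof (induction B arbitrary: n rule: finite_linorder_max_induct)
  case empty
  thus ?case using gap_fact_insert_Max[of "{}" a n] by simp
next
  case (insert b B)
  have "gap_fact n (insert a (insert b B)) = gap_fact n (insert b (insert a B))"
    by (simp add: insert_commute)
  also have "\<dots> = fact (n - b) * gap_fact b (insert a B)"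
    using insert by (intro gap_fact_insert_Max) auto
  also have "gap_fact b (insert a B) = gap_fact (b - a) ((\<lambda>x. x - a) ` B) * fact a"
  proof (rule insert.IH)
    show "B \<subseteq> {a<..b}"
    proof
      fix x assume "x \<in> B"
      with insert.hyps insert.prems have "x < b" "a < x" by auto
      thus "x \<in> {a<..b}" by simp
    qed
  qed (use insert.prems in auto)
  also have "fact (n - b) * (gap_fact (b - a) ((\<lambda>x. x - a) ` B) * fact a) =
      gap_fact (n - a) (insert (b - a) ((\<lambda>x. x - a) ` B)) * fact a"
    using insert by (subst gap_fact_insert_Max) (auto simp: diff_less_mono)
  finally show ?case by simp
qed

lemma gap_fact_lessThan: "gap_fact n {..<n} = 1"
proof (induction n)
  case (Suc n)
  thus ?case using gap_fact_insert_Max[of "{..<n}" n "Suc n"] by (simp add: lessThan_Suc)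
qed (simp add: gap_fact_def)

section \<open>Upper bounds for gap products\<close>

text \<open>Two positive gaps p + 1 and y are merged into p + y. Raising p by one multiplies the
  left by p + 2 and the right by p + y + 1, which is no smaller because y >= 1.\<close>

lemma fact_mult_fact_le:
  assumes "y > 0"
  shows "fact (Suc p) * fact y \<le> (fact (p + y) :: nat)"
proof (induction p)
  case (Suc p)
  have "fact (Suc (Suc p)) * fact y = Suc (Suc p) * (fact (Suc p) * fact y :: nat)"
    by (simp only: fact_Suc of_nat_id mult.assoc)
  also have "\<dots> \<le> Suc (p + y) * fact (p + y)"
    using assms by (intro mult_mono Suc) auto
  finally show ?case by simp
qed auto

text \<open>B cuts a into card B + 1 gaps, all positive because B avoids 0 and a. Repeated merging
  shows that the product of their factorials is largest when all gaps but one equal 1.\<close>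

lemma gap_fact_le:
  assumes "finite B" "B \<subseteq> {0<..<a}"
  shows "gap_fact a B \<le> fact (a - card B)"
  using assms
proof (induction B arbitrary: a rule: finite_linorder_max_induct)
  case (insert b A)
  have sub: "A \<subseteq> {0<..<b}" using insert by auto
  hence "card A \<le> card {0<..<b}" by (intro card_mono) auto
  moreover have b: "0 < b" "b < a" using insert by auto
  ultimately have pos: "b - card A > 0" by auto
  have "b \<notin> A" using insert by auto
  have "gap_fact a (insert b A) = fact (a - b) * gap_fact b A"
    using insert by (intro gap_fact_insert_Max) auto
  also have "\<dots> \<le> fact (Suc (a - b - 1)) * fact (b - card A)"
  proof (rule mult_le_mono)
    show "fact (a - b) \<le> (fact (Suc (a - b - 1)) :: nat)" using b by (intro fact_mono_nat) simp
  qed (rule insert.IH[OF sub])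
  also have "\<dots> \<le> fact (a - b - 1 + (b - card A))"
    by (rule fact_mult_fact_le[OF pos])
  also have "a - b - 1 + (b - card A) = a - card (insert b A)"
    using insert \<open>b \<notin> A\<close> b pos by simp
  finally show ?case .
qed simp

text \<open>Since \<open>fact N\<close> over \<open>gap_fact N B\<close> is the number of chains
  with size set B in an N-cube, this bounds that number below by m(m-1)...(m - card B + 1).\<close>

lemma binomial_gap_fact_le:
  assumes "B \<subseteq> {0<..<N}" "m \<le> N"
  shows "(m choose card B) * fact (card B) * gap_fact N B \<le> fact N"
proof -
  have fin: "finite B" using assms(1) finite_subset by blast
  have "card B \<le> card {0<..<N}" using assms by (intro card_mono) auto
  hence le: "card B \<le> N" by simp
  have "(m choose card B) * fact (card B) * gap_fact N B
      \<le> (N choose card B) * fact (card B) * fact (N - card B)"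
    using assms fin by (intro mult_mono gap_fact_le binomial_right_mono) auto
  also have "\<dots> = fact N"
    using binomial_fact_lemma[OF le] by (simp add: mult_ac)
  finally show ?thesis .
qed

text \<open>The supersets of a fixed a-set form a cube of dimension n - a, to which
  \<open>binomial_gap_fact_le\<close> applies.\<close>

lemma level_bound_above:
  assumes "B \<subseteq> {a<..<n}" "m \<le> n - a" "a \<le> n"
  shows "(m choose card B) * fact (card B) * (n choose a) * gap_fact n (insert a B) \<le> fact n"
proof -
  have fin: "finite B" using assms(1) finite_subset by blast
  let ?B = "(\<lambda>x. x - a) ` B"
  have card: "card ?B = card B"
    using assms by (intro card_image inj_onI) (auto dest!: subsetD)
  have "?B \<subseteq> {0<..<n - a}"
  proof
    fix y assume "y \<in> ?B"
    then obtain x where "x \<in> B" "y = x - a" by blast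
    with assms(1) have "a < x" "x < n" "y = x - a" by auto
    thus "y \<in> {0<..<n - a}" by auto
  qed
  hence *: "(m choose card B) * fact (card B) * gap_fact (n - a) ?B \<le> fact (n - a)"
    using binomial_gap_fact_le[of ?B "n - a" m] assms(2) card by simp
  have "gap_fact n (insert a B) = gap_fact (n - a) ?B * fact a"
    using assms fin by (intro gap_fact_insert_Min) auto
  hence "(m choose card B) * fact (card B) * (n choose a) * gap_fact n (insert a B)
     = (n choose a) * fact a * ((m choose card B) * fact (card B) * gap_fact (n - a) ?B)"
    by (simp add: mult_ac)
  also have "\<dots> \<le> (n choose a) * fact a * fact (n - a)"
    by (intro mult_left_mono *) auto
  also have "\<dots> = fact n"
    using binomial_fact_lemma[OF assms(3)] by (simp add: mult_ac)
  finally show ?thesis .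
qed

text \<open>Dual case: the subsets of a fixed a-set form a cube of dimension a.\<close>

lemma level_bound_below:
  assumes "B \<subseteq> {0<..<a}" "m \<le> a" "a \<le> n"
  shows "(m choose card B) * fact (card B) * (n choose a) * gap_fact n (insert a B) \<le> fact n"
proof -
  have fin: "finite B" using assms(1) finite_subset by blast
  have "gap_fact n (insert a B) = fact (n - a) * gap_fact a B"
    using assms fin by (intro gap_fact_insert_Max) auto
  hence "(m choose card B) * fact (card B) * (n choose a) * gap_fact n (insert a B)
     = (n choose a) * fact (n - a) * ((m choose card B) * fact (card B) * gap_fact a B)"
    by (simp add: mult_ac)
  also have "\<dots> \<le> (n choose a) * fact (n - a) * fact a"
    using assms by (intro mult_left_mono binomial_gap_fact_le) auto
  also have "\<dots> = fact n"
    using binomial_fact_lemma[OF assms(3)] by (simp add: mult_ac)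
  finally show ?thesis .
qed

subsection \<open>Sums of largest elements\<close>

text \<open>Greedy exchange: against the head y, remove from A either y itself or, if y does not
  occur in A, any element z <= y; the rest of A fits into the tail.\<close>

lemma sum_mset_le_take_sorted:
  fixes ys :: "nat list"
  assumes "sorted_wrt (\<ge>) ys" "A \<subseteq># mset ys"
  shows "sum_mset A \<le> sum_list (take (size A) ys)"
  using assms
proof (induction ys arbitrary: A)
  case (Cons y ys)
  show ?case
  proof (cases "A = {#}")
    case False
    obtain z where z: "z \<in># A" "z \<le> y" "A - {#z#} \<subseteq># mset ys"
    proof (cases "y \<in># A")
      case True
      thus ?thesis using that[of y] Cons.prems
        by (simp add: subset_eq_diff_conv)
    next
      case y: False
      obtain z where z: "z \<in># A" using False by blast
      have "A \<subseteq># mset ys"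
      proof (rule mset_subset_eqI)
        fix x show "count A x \<le> count (mset ys) x"
          using mset_subset_eq_count[OF Cons.prems(2), of x] y
          by (cases "x = y") (auto simp: not_in_iff)
      qed
      moreover from this z have "z \<in> set ys" by (metis mset_subset_eqD set_mset_mset)
      ultimately show ?thesis using that[of z] z Cons.prems(1)
        by (auto intro: subset_mset.order_trans[OF diff_subset_eq_self])
    qed
    obtain B where B: "A = add_mset z B" using z(1) by (metis insert_DiffM)
    have "sum_mset B \<le> sum_list (take (size B) ys)"
      using Cons.IH[of B] Cons.prems z B by simp
    thus ?thesis using z B by simp
  qed simp
qed simp

text \<open>Settles the cases where the left-hand side of the level inequality is nonpositive.
  Multisets keep equal coefficients of different levels apart.\<close>

lemma sum_binomials_le_largest:
  assumes "X \<subseteq> {..n}" "card X \<le> m"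
  shows "(\<Sum>i\<in>X. n choose i) \<le> largest_binomials_sum n m"
proof -
  have fin: "finite X" using assms(1) finite_subset by blast
  let ?ys = "rev (sort (map (\<lambda>i. n choose i) [0..<Suc n]))"
  let ?A = "image_mset (\<lambda>i. n choose i) (mset_set X)"
  have "mset_set X \<subseteq># mset_set {..n}"
    using assms by (intro subset_imp_msubset_mset_set) auto
  hence "?A \<subseteq># image_mset (\<lambda>i. n choose i) (mset_set {..n})"
    by (rule image_mset_subseteq_mono)
  also have "mset_set {..n} = mset [0..<Suc n]"
    by (metis atLeast_upt lessThan_Suc_atMost mset_upt atLeast0LessThan)
  finally have "?A \<subseteq># mset ?ys" by (simp only: mset_rev mset_sort mset_map)
  moreover have "sorted_wrt (\<ge>) ?ys" by (simp add: sorted_wrt_rev)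
  ultimately have "sum_mset ?A \<le> sum_list (take (size ?A) ?ys)"
    by (intro sum_mset_le_take_sorted)
  also have "size ?A = card X" by simp
  also have "sum_list (take (card X) ?ys) \<le> sum_list (take m ?ys)"
  proof -
    have "take m ?ys = take (card X) ?ys @ take (m - card X) (drop (card X) ?ys)"
      using assms(2) by (metis le_add_diff_inverse take_add)
    thus ?thesis by (metis sum_list_append le_add1)
  qed
  finally show ?thesis by (simp add: largest_binomials_sum_def sum_unfold_sum_mset)
qed

subsection \<open>Unions of full levels\<close>

text \<open>The summand on the right is the number of chains with size set T. Removing level a
  lowers the left side by c * (n choose a), and a single T containing a pays for it.\<close>

lemma level_union_bound:
  fixes n k :: nat
  defines "c \<equiv> ((n + k) div 2 choose (k - 1)) * fact (k - 1)"
  assumes n: "n \<ge> 1" and k: "k \<ge> 2" and X: "X \<subseteq> {..n}"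
  shows "real c * (real (\<Sum>a\<in>X. n choose a) - real (largest_binomials_sum n (k - 1)))
    \<le> (\<Sum>T | T \<subseteq> X \<and> card T = k. fact n / real (gap_fact n T))"
  using X
proof (induction "card X" arbitrary: X rule: less_induct)
  case less
  note X = less.prems
  have fin: "finite X" using X finite_subset by blast
  let ?w = "\<lambda>T. fact n / real (gap_fact n T)"
  let ?L = "largest_binomials_sum n (k - 1)"
  have nonneg: "0 \<le> sum ?w A" for A by (intro sum_nonneg) auto
  have small: ?case if "(\<Sum>a\<in>X. n choose a) \<le> ?L"
  proof -
    have "real c * (real (\<Sum>a\<in>X. n choose a) - real ?L) \<le> 0"
      using that by (intro mult_nonneg_nonpos) linarith+
    also have "\<dots> \<le> sum ?w {T. T \<subseteq> X \<and> card T = k}" by (rule nonneg)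
    finally show ?thesis .
  qed
  \<comment> \<open>In the second case the farthest level is 0 or n, and its k - 1 companions
    include the opposite end, so the gap bounds do not apply.\<close>
  consider "card X \<le> k - 1" | "card X = k" "{0, n} \<subseteq> X"
    | "card X \<ge> k" "\<not> (card X = k \<and> {0, n} \<subseteq> X)" by linarith
  thus ?case
  proof cases
    case 1
    thus ?thesis by (intro small sum_binomials_le_largest X)
  next
    case 2
    show ?thesis
    proof (cases "X = {..n}")
      case True
      hence kn: "k = Suc n" using 2 by simp
      \<comment> \<open>the only case with both extreme levels where the left-hand side can be positive\<close>
      have "(\<Sum>a<n. n choose a) \<le> ?L"
        by (intro sum_binomials_le_largest) (auto simp: kn)
      moreover have "(\<Sum>a\<in>X. n choose a) = (\<Sum>a<n. n choose a) + 1"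
        by (simp add: True flip: lessThan_Suc_atMost)
      ultimately have "real (\<Sum>a\<in>X. n choose a) - real ?L \<le> 1" by linarith
      hence "real c * (real (\<Sum>a\<in>X. n choose a) - real ?L) \<le> real c * 1"
        by (intro mult_left_mono) auto
      \<comment> \<open>Here k - 1 = n and (n + k) div 2 = n, so the binomial coefficient in c is
        1.\<close>
      also have "real c * 1 = fact n" by (simp add: c_def kn)
      also have "fact n = ?w X"
      proof -
        have "gap_fact n X = 1"
          using gap_fact_insert_Max[of "{..<n}" n n] gap_fact_lessThan[of n]
          by (simp add: True lessThan_Suc flip: lessThan_Suc_atMost)
        thus ?thesis by simp
      qed
      also have "\<dots> \<le> sum ?w {T. T \<subseteq> X \<and> card T = k}"
        using 2 fin by (intro member_le_sum) auto
      finally show ?thesis .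
    next
      case False
      \<comment> \<open>The end levels have total weight 2. Replacing both by a missing interior
        level j, of weight at least n >= 2, leaves k - 1 levels without lowering the sum.\<close>
      then obtain j where j: "j \<le> n" "j \<notin> X" using X by auto
      have "j \<noteq> 0" "j \<noteq> n" using j(2) 2(2) by (metis insert_subset)+
      hence jn: "0 < j" "j < n" using j(1) by simp_all
      define Y where "Y = X - {0, n}"
      have XY: "X = insert 0 (insert n Y)" using 2(2) by (auto simp: Y_def)
      have Y: "finite Y" "0 \<notin> Y" "n \<notin> Y" "j \<notin> Y" using fin j by (auto simp: Y_def)
      have "(\<Sum>a\<in>X. n choose a) = 2 + (\<Sum>a\<in>Y. n choose a)"
        using Y n by (simp add: XY)
      also have "2 \<le> n choose j"
      proof -
        have "n choose 1 \<le> n choose j"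
          using jn by (intro binomial_le_central[of n j 1]) auto
        thus ?thesis using jn by simp
      qed
      hence "2 + (\<Sum>a\<in>Y. n choose a) \<le> (\<Sum>a\<in>insert j Y. n choose a)"
        using Y by simp
      also have "\<dots> \<le> ?L"
      proof (rule sum_binomials_le_largest)
        show "insert j Y \<subseteq> {..n}" using X j(1) by (auto simp: Y_def)
        have "card X = card Y + 2" using Y n by (simp add: XY)
        thus "card (insert j Y) \<le> k - 1" using 2(1) Y by simp
      qed
      finally show ?thesis by (rule small)
    qed
  next
    case 3
    have "X \<noteq> {}" using 3(1) k by auto
    \<comment> \<open>Twice the distance from n/2, so that it is an integer.\<close>
    define d where "d = (\<lambda>a. \<bar>int n - 2 * int a\<bar>)"
    obtain a where a: "a \<in> X" and far: "\<And>b. b \<in> X \<Longrightarrow> d b \<le> d a"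
    proof -
      have "Max (d ` X) \<in> d ` X" using fin \<open>X \<noteq> {}\<close> by simp
      then obtain a where a: "a \<in> X" "d a = Max (d ` X)" by (metis imageE)
      hence "d b \<le> d a" if "b \<in> X" for b using fin that by simp
      thus ?thesis using that a(1) by blast
    qed
    have an: "a \<le> n" using a X by auto
    have ends: "a \<in> {0, n}" if "0 \<in> X \<or> n \<in> X"
    proof -
      have "d 0 = int n" "d n = int n" by (simp_all add: d_def)
      hence "int n \<le> d a" using that far by metis
      hence "a = 0 \<or> a = n" using an unfolding d_def by linarith
      thus ?thesis by simp
    qed
    \<comment> \<open>If both ends lie in X, then a is one of them and card X > k. Otherwise the
      only possible end in X is a itself, so deleting a removes it.\<close>
    have "k - 1 \<le> card (X - {a} - {0, n})"
    proof (cases "{0, n} \<subseteq> X")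
      case True
      have "a \<in> {0, n}" using ends True by blast
      hence "X - {a} - {0, n} = X - {0, n}" by auto
      thus ?thesis using True 3 fin n by (simp add: card_Diff_subset)
    next
      case False
      have "X - {a} - {0, n} = X - {a}"
        using False ends a by auto
      thus ?thesis using 3 fin a by simp
    qed
    then obtain B where B: "B \<subseteq> X - {a} - {0, n}" "card B = k - 1" "finite B"
      by (rule obtain_subset_with_card_n)
    have close: "d b \<le> d a" "0 < b" "b < n" "b \<noteq> a" if "b \<in> B" for b
    proof -
      have b: "b \<in> X - {a} - {0, n}" using B(1) that by (rule subsetD)
      hence "b \<in> {..n}" using X by auto
      thus "d b \<le> d a" "0 < b" "b < n" "b \<noteq> a" using b far by simp_all
    qed
    have "c * (n choose a) * gap_fact n (insert a B) \<le> fact n"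
    proof (cases "2 * a \<le> n")
      case True
      have sub: "B \<subseteq> {a<..n - a}"
      proof
        fix b assume "b \<in> B"
        have "a < b" "a + b \<le> n"
          using close[OF \<open>b \<in> B\<close>] True unfolding d_def by linarith+
        thus "b \<in> {a<..n - a}" by simp
      qed
      \<comment> \<open>The interval has n - 2a elements, hence k - 1 <= n - 2a, that is, 2(n - a)
        >= n + k - 1. Integrality gives the dimension (n + k) div 2.\<close>
      hence "card B \<le> card {a<..n - a}" by (intro card_mono) auto
      hence "(n + k) div 2 \<le> n - a" using B(2) k True by simp
      moreover have "B \<subseteq> {a<..<n}" using sub close by auto
      ultimately show ?thesis using level_bound_above[of B a n] an B(2) by (simp add: c_def)
    next
      case False
      have sub: "B \<subseteq> {n - a..<a}"
      proof
        fix b assume "b \<in> B"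
        have "b < a" "n \<le> a + b"
          using close[OF \<open>b \<in> B\<close>] False unfolding d_def by linarith+
        thus "b \<in> {n - a..<a}" by simp
      qed
      hence "card B \<le> card {n - a..<a}" by (intro card_mono) auto
      hence "(n + k) div 2 \<le> a" using B(2) k False by simp
      moreover have "B \<subseteq> {0<..<a}" using sub close by auto
      ultimately show ?thesis using level_bound_below[of B a _ n] an B(2) by (simp add: c_def)
    qed
    hence "real (c * (n choose a) * gap_fact n (insert a B)) \<le> real (fact n)"
      by (rule of_nat_mono)
    hence w: "real c * real (n choose a) \<le> ?w (insert a B)"
      using gap_fact_pos[of "insert a B" n] B(3) by (simp add: pos_le_divide_eq)
    have cB: "card (insert a B) = k" using B k by (subst card_insert_disjoint) auto
    have "real (\<Sum>b\<in>X. n choose b) = real (n choose a) + real (\<Sum>b\<in>X - {a}. n choose b)"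
      using fin a by (simp add: sum.remove)
    hence "real c * (real (\<Sum>b\<in>X. n choose b) - real ?L) =
        real c * real (n choose a) + real c * (real (\<Sum>b\<in>X - {a}. n choose b) - real ?L)"
      by (simp add: algebra_simps)
    also have "\<dots> \<le> ?w (insert a B) + sum ?w {T. T \<subseteq> X - {a} \<and> card T = k}"
      using X by (intro add_mono w less.hyps card_Diff1_less fin a) auto
    \<comment> \<open>The set \<open>insert a B\<close> contains a, so it is not among the subsets
      of \<open>X - {a}\<close>.\<close>
    also have "\<dots> = sum ?w (insert (insert a B) {T. T \<subseteq> X - {a} \<and> card T = k})"
      using fin by (subst sum.insert) auto
    also have "\<dots> \<le> sum ?w {T. T \<subseteq> X \<and> card T = k}"
      using fin a B cB by (intro sum_mono2) auto
    finally show ?thesis .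
  qed
qed

subsection \<open>Permutations and chains\<close>

definition prefix_sets :: "'a list \<Rightarrow> 'a set set" where
  "prefix_sets xs = (\<lambda>i. set (take i xs)) ` {..length xs}"

lemma prefix_sets_linear:
  assumes "A \<in> prefix_sets xs" "B \<in> prefix_sets xs"
  shows "A \<subseteq> B \<or> B \<subseteq> A"
proof -
  obtain i j where "A = set (take i xs)" "B = set (take j xs)"
    using assms by (auto simp: prefix_sets_def)
  thus ?thesis by (metis nat_le_linear set_take_subset_set_take)
qed

text \<open>A prefix longer than ys contains all of \<open>set ys\<close>, so it cannot be a proper
  subset of it.\<close>

lemma prefix_sets_append_iff:
  assumes "A \<subset> set ys"
  shows "A \<in> prefix_sets (ys @ zs) \<longleftrightarrow> A \<in> prefix_sets ys"
proof
  assume "A \<in> prefix_sets (ys @ zs)"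
  then obtain i where i: "A = set (take i (ys @ zs))" by (auto simp: prefix_sets_def)
  have "i \<le> length ys" using i assms by (rule_tac ccontr) auto
  thus "A \<in> prefix_sets ys" using i by (auto simp: prefix_sets_def)
next
  assume "A \<in> prefix_sets ys"
  then obtain i where "i \<le> length ys" "A = set (take i ys)" by (auto simp: prefix_sets_def)
  thus "A \<in> prefix_sets (ys @ zs)"
    by (auto simp: prefix_sets_def intro!: image_eqI[of _ _ i])
qed

text \<open>Split at the largest set M: first a permutation of M through the smaller sets, then an
  arbitrary permutation of U - M. This is the recursion \<open>gap_fact_insert_Max\<close>; U varies
  in the induction because it shrinks to M.\<close>

lemma card_permutations_through_chain:
  assumes "finite U" "S \<subseteq> Pow U" "chain\<^sub>\<subseteq> S"
  shows "card {xs \<in> permutations_of_set U. S \<subseteq> prefix_sets xs} = gap_fact (card U) (card ` S)"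
  using assms
proof (induction "card S" arbitrary: S U)
  case 0
  have "finite S" using 0 by (meson finite_Pow_iff finite_subset)
  hence "S = {}" using 0 by simp
  thus ?case using 0 by simp
next
  case (Suc m)
  have fin: "finite S" using Suc.prems by (meson finite_Pow_iff finite_subset)
  have "S \<noteq> {}" using Suc.hyps(2) by auto
  obtain M where M: "M \<in> S" "\<And>A. A \<in> S \<Longrightarrow> A \<subseteq> M"
  proof -
    have "\<exists>M\<in>S. \<forall>A\<in>S. M \<subseteq> A \<longrightarrow> A = M"
      using finite_has_maximal[OF fin \<open>S \<noteq> {}\<close>] by metis
    thus ?thesis using that Suc.prems(3) unfolding chain_subset_def by metis
  qed
  define S' where "S' = S - {M}"
  have MU: "M \<subseteq> U" "finite M" using M(1) Suc.prems by (auto intro: finite_subset)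
  have S: "S = insert M S'" "M \<notin> S'" using M by (auto simp: S'_def)
  have sub: "A \<subset> M" if "A \<in> S'" for A using that M by (auto simp: S'_def)
  have IH: "card {xs \<in> permutations_of_set M. S' \<subseteq> prefix_sets xs} = gap_fact (card M) (card ` S')"
    using Suc.hyps(2) fin Suc.prems(3) S sub MU
    by (intro Suc.hyps(1)) (auto simp: chain_subset_def)
  let ?P = "{ys \<in> permutations_of_set M. S' \<subseteq> prefix_sets ys} \<times> permutations_of_set (U - M)"
  have "bij_betw (\<lambda>(ys, zs). ys @ zs) ?P {xs \<in> permutations_of_set U. S \<subseteq> prefix_sets xs}"
  proof (rule bij_betwI')
    fix p q assume "p \<in> ?P" "q \<in> ?P"
    moreover from this have "length (fst p) = card M" "length (fst q) = card M"
      by (auto simp: length_finite_permutations_of_set)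
    ultimately show "((case p of (ys, zs) \<Rightarrow> ys @ zs) = (case q of (ys, zs) \<Rightarrow> ys @ zs)) = (p = q)"
      by (auto split: prod.splits)
  next
    fix p assume p: "p \<in> ?P"
    obtain ys zs where [simp]: "p = (ys, zs)" by (cases p)
    have ys: "set ys = M" "distinct ys" "S' \<subseteq> prefix_sets ys" and zs: "set zs = U - M" "distinct zs"
      using p by (auto dest: permutations_of_setD)
    have "M \<in> prefix_sets (ys @ zs)"
      using ys by (auto simp: prefix_sets_def intro!: image_eqI[of _ _ "length ys"])
    moreover have "S' \<subseteq> prefix_sets (ys @ zs)"
      using ys sub prefix_sets_append_iff[of _ ys zs] by blast
    ultimately show "(case p of (ys, zs) \<Rightarrow> ys @ zs) \<in> {xs \<in> permutations_of_set U. S \<subseteq> prefix_sets xs}"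
      using ys zs MU S by (auto intro!: permutations_of_setI)
  next
    fix xs assume xs: "xs \<in> {xs \<in> permutations_of_set U. S \<subseteq> prefix_sets xs}"
    then obtain i where i: "M = set (take i xs)" using S by (auto simp: prefix_sets_def)
    define ys zs where "ys = take i xs" and "zs = drop i xs"
    have xs_eq: "xs = ys @ zs" by (simp add: ys_def zs_def)
    have d: "set (ys @ zs) = U" "distinct (ys @ zs)"
      using xs by (auto simp flip: xs_eq dest: permutations_of_setD)
    have M_ys: "M = set ys" using i by (simp add: ys_def)
    have "S' \<subseteq> prefix_sets ys"
    proof
      fix A assume A: "A \<in> S'"
      hence "A \<in> prefix_sets (ys @ zs)" using xs S(1) unfolding xs_eq by auto
      thus "A \<in> prefix_sets ys"
        using sub[OF A] M_ys by (simp add: prefix_sets_append_iff)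
    qed
    hence "(ys, zs) \<in> ?P"
      using d M_ys by (auto intro!: permutations_of_setI)
    thus "\<exists>p\<in>?P. xs = (case p of (ys, zs) \<Rightarrow> ys @ zs)"
      using xs_eq by (intro bexI[of _ "(ys, zs)"]) simp_all
  qed
  hence "card {xs \<in> permutations_of_set U. S \<subseteq> prefix_sets xs} = card ?P"
    by (rule bij_betw_same_card[symmetric])
  also have "\<dots> = gap_fact (card M) (card ` S') * fact (card U - card M)"
    using IH MU Suc.prems(1) by (simp add: card_cartesian_product card_Diff_subset)
  also have "\<dots> = gap_fact (card U) (card ` S)"
  proof -
    have "gap_fact (card U) (insert (card M) (card ` S')) =
        fact (card U - card M) * gap_fact (card M) (card ` S')"
      using fin sub MU(2) S(1) by (intro gap_fact_insert_Max) (auto intro: psubset_card_mono)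
    thus ?thesis using S(1) by simp
  qed
  finally show ?case .
qed

section \<open>Double counting over maximal chains\<close>

text \<open>On one maximal chain, taking sizes and taking prefixes are inverse bijections between
  k-chains of F and k-sets of levels. The weight g is left free to serve both for single sets (k =
  1) and for k-chains.\<close>

lemma chain_weight_sum:
  fixes g :: "nat set \<Rightarrow> real"
  assumes U: "finite U" and F: "F \<subseteq> Pow U"
  shows "(\<Sum>xs\<in>permutations_of_set U.
           \<Sum>T | T \<subseteq> {i. i \<le> card U \<and> set (take i xs) \<in> F} \<and> card T = k. g T)
       = (\<Sum>S\<in>k_chains k F. g (card ` S) * real (gap_fact (card U) (card ` S)))"
proof -
  have finF: "finite F" using U F by (meson finite_Pow_iff finite_subset)
  have finC: "finite (k_chains k F)"
    by (rule finite_subset[of _ "Pow F"]) (use finF in \<open>auto simp: k_chains_def chains_def\<close>)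
  have *: "(\<Sum>T | T \<subseteq> {i. i \<le> card U \<and> set (take i xs) \<in> F} \<and> card T = k. g T) =
      (\<Sum>S | S \<in> k_chains k F \<and> S \<subseteq> prefix_sets xs. g (card ` S))"
    if xs: "xs \<in> permutations_of_set U" for xs
  proof -
    let ?f = "\<lambda>i. set (take i xs)"
    have len: "length xs = card U" using xs by (simp add: length_finite_permutations_of_set)
    have card_take: "card (?f i) = i" if "i \<le> card U" for i
      using that len xs by (simp add: distinct_card permutations_of_setD)
    have take_card: "?f (card A) = A" if "A \<in> prefix_sets xs" for A
      using that card_take len by (auto simp: prefix_sets_def)
    show ?thesis
    proof (rule sum.reindex_bij_witness[of _ "image card" "image ?f"])
      fix T assume T: "T \<in> {T. T \<subseteq> {i. i \<le> card U \<and> ?f i \<in> F} \<and> card T = k}"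
      hence T': "T \<subseteq> {..card U}" by auto
      show c: "card ` ?f ` T = T" 
      proof -
        have "card ` ?f ` T = (\<lambda>i. i) ` T"
          unfolding image_image using T' card_take by (intro image_cong) auto
        thus ?thesis by simp
      qed
      have "inj_on ?f T"
        using T' card_take by (intro inj_on_inverseI[of _ card]) auto
      hence "card (?f ` T) = k" using T by (simp add: card_image)
      moreover have "?f ` T \<subseteq> prefix_sets xs" using T' len by (auto simp: prefix_sets_def)
      moreover from this have "chain\<^sub>\<subseteq> (?f ` T)"
        unfolding chain_subset_def using prefix_sets_linear by blast
      ultimately show "?f ` T \<in> {S. S \<in> k_chains k F \<and> S \<subseteq> prefix_sets xs}"
        using T by (auto simp: k_chains_def chains_def)
      show "g (card ` ?f ` T) = g T" by (simp only: c)
    next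
      fix S assume S: "S \<in> {S. S \<in> k_chains k F \<and> S \<subseteq> prefix_sets xs}"
      show c: "?f ` card ` S = S" 
      proof -
        have "?f ` card ` S = (\<lambda>A. A) ` S"
          unfolding image_image using S take_card by (intro image_cong) auto
        thus ?thesis by simp
      qed
      have SF: "S \<subseteq> F" "card S = k" using S by (auto simp: k_chains_def chains_def)
      have le: "card A \<le> card U" if "A \<in> S" for A
        using that SF F U by (auto intro: card_mono)
      have "inj_on card S"
        using S take_card by (intro inj_on_inverseI[of _ ?f]) auto
      hence "card (card ` S) = card S" by (rule card_image)
      moreover have "?f (card A) \<in> F" if "A \<in> S" for A using that c SF by blast
      ultimately show "card ` S \<in> {T. T \<subseteq> {i. i \<le> card U \<and> ?f i \<in> F} \<and> card T = k}"
        using SF le by auto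
    qed
  qed
  \<comment> \<open>The condition on S becomes an indicator, so that the range no longer depends on
    xs and the sums can be swapped.\<close>
  have "(\<Sum>xs\<in>permutations_of_set U.
           \<Sum>T | T \<subseteq> {i. i \<le> card U \<and> set (take i xs) \<in> F} \<and> card T = k. g T)
      = (\<Sum>xs\<in>permutations_of_set U. \<Sum>S\<in>k_chains k F. if S \<subseteq> prefix_sets xs then g (card ` S) else 0)"
    using finC by (intro sum.cong refl) (simp add: * sum.inter_filter)
  also have "\<dots> = (\<Sum>S\<in>k_chains k F. \<Sum>xs\<in>permutations_of_set U. if S \<subseteq> prefix_sets xs then g (card ` S) else 0)"
    by (rule sum.swap)
  also have "\<dots> = (\<Sum>S\<in>k_chains k F. g (card ` S) * real (gap_fact (card U) (card ` S)))"
  proof (intro sum.cong refl)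
    fix S assume "S \<in> k_chains k F"
    hence "card {xs \<in> permutations_of_set U. S \<subseteq> prefix_sets xs} = gap_fact (card U) (card ` S)"
      using U F by (intro card_permutations_through_chain) (auto simp: k_chains_def chains_def)
    thus "(\<Sum>xs\<in>permutations_of_set U. if S \<subseteq> prefix_sets xs then g (card ` S) else 0)
        = g (card ` S) * real (gap_fact (card U) (card ` S))"
      by (simp flip: sum.inter_filter)
  qed
  finally show ?thesis .
qed

lemma sum_card_1_subsets: "(\<Sum>T | T \<subseteq> A \<and> card T = 1. g T) = (\<Sum>a\<in>A. g {a})"
proof -
  have "{T. T \<subseteq> A \<and> card T = 1} = (\<lambda>a. {a}) ` A" by (auto simp: card_1_singleton_iff)
  thus ?thesis by (simp add: sum.reindex)
qed

text \<open>A set of size i lies on i! (n - i)! of the maximal chains, where n is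
  \<open>card U\<close>; the weight n choose i makes its contribution exactly n!.\<close>

lemma level_weight_sum:
  assumes U: "finite U" and F: "F \<subseteq> Pow U"
  shows "(\<Sum>xs\<in>permutations_of_set U.
           \<Sum>i | i \<le> card U \<and> set (take i xs) \<in> F. real (card U choose i)) = fact (card U) * real (card F)"
proof -
  let ?g = "\<lambda>T::nat set. \<Sum>i\<in>T. real (card U choose i)"
  have eq: "k_chains 1 F = {S. S \<subseteq> F \<and> card S = 1}"
    by (auto simp: k_chains_def chains_def chain_subset_def card_1_singleton_iff)
  have "(\<Sum>xs\<in>permutations_of_set U.
           \<Sum>i | i \<le> card U \<and> set (take i xs) \<in> F. real (card U choose i))
      = (\<Sum>A\<in>F. real (card U choose card A) * real (gap_fact (card U) {card A}))"
    using chain_weight_sum[OF U F, where k = 1 and g = ?g] by (simp only: eq sum_card_1_subsets) simp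
  also have "\<dots> = (\<Sum>A\<in>F. fact (card U))"
  proof (intro sum.cong refl)
    fix A assume "A \<in> F"
    hence "card A \<le> card U" using U F by (auto intro: card_mono)
    hence "(card U choose card A) * gap_fact (card U) {card A} = fact (card U)"
      using gap_fact_insert_Max[of "{}" "card A" "card U"] binomial_fact_lemma[of "card A" "card U"]
      by (simp add: mult_ac)
    thus "real (card U choose card A) * real (gap_fact (card U) {card A}) = fact (card U)"
      by (metis of_nat_fact of_nat_mult)
  qed
  finally show ?thesis by simp
qed

theorem theorem1p3:
  fixes n k :: nat and t :: int and F :: "nat set set"
  assumes "n \<ge> 1" and "k \<ge> 2"
    and "F \<subseteq> Pow {1..n}"
    and "int (card F) = int (largest_binomials_sum n (k - 1)) + t"
  shows "int (card (k_chains k F)) \<ge> t * int (((n + k) div 2) choose (k - 1)) * fact (k - 1)"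
proof -
  let ?U = "{1..n}"
  let ?L = "largest_binomials_sum n (k - 1)"
  let ?X = "\<lambda>xs. {i. i \<le> n \<and> set (take i xs) \<in> F}"
  define c where "c = ((n + k) div 2 choose (k - 1)) * (fact (k - 1) :: nat)"
  let ?w = "\<lambda>T. fact n / real (gap_fact n T)"
  have "real (card F) = real ?L + real_of_int t"
    using assms(4) by (metis of_int_add of_int_of_nat_eq)
  hence "fact n * (real c * real_of_int t)
      = real c * (fact n * real (card F) - fact n * real ?L)"
    by (simp add: algebra_simps)
  \<comment> \<open>Summing over all n! permutations replaces the expectation:
    \<open>level_weight_sum\<close> supplies card F, and the constant is added n! times.\<close>
  also have "\<dots> = (\<Sum>xs\<in>permutations_of_set ?U. real c * (real (\<Sum>a\<in>?X xs. n choose a) - real ?L))"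
    using level_weight_sum[of ?U F] assms(3)
    by (simp add: sum_subtractf flip: sum_distrib_left)
  also have "\<dots> \<le> (\<Sum>xs\<in>permutations_of_set ?U. \<Sum>T | T \<subseteq> ?X xs \<and> card T = k. ?w T)"
    unfolding c_def by (intro sum_mono level_union_bound assms) auto
  also have "\<dots> = (\<Sum>S\<in>k_chains k F. ?w (card ` S) * real (gap_fact n (card ` S)))"
    using chain_weight_sum[of ?U F ?w k] assms(3) by simp
  \<comment> \<open>The weight cancels the number of permutations through a chain, so every chain
    counts equally.\<close>
  also have "\<dots> = (\<Sum>S\<in>k_chains k F. fact n)"
  proof (intro sum.cong refl)
    fix S assume "S \<in> k_chains k F"
    hence "finite S"
      using assms(2) by (intro card_ge_0_finite) (simp add: k_chains_def)
    hence "gap_fact n (card ` S) > 0" by (simp add: gap_fact_pos)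
    thus "?w (card ` S) * real (gap_fact n (card ` S)) = fact n" by simp
  qed
  also have "\<dots> = fact n * real (card (k_chains k F))" by simp
  finally have "real c * real_of_int t \<le> real (card (k_chains k F))"
    by simp
  hence "real_of_int (int c * t) \<le> real_of_int (int (card (k_chains k F)))" by simp
  hence "int c * t \<le> int (card (k_chains k F))" by (simp only: of_int_le_iff)
  thus ?thesis by (simp add: c_def mult_ac)
qed

end
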